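(* Let $q$ be a prime power, $n>0$, and let $\boldsymbol{\alpha} \in \mathcal{L}_n (r , \rho_1 , \pi_1 )$. Put $c_1 := r$ and $c_2 := n-r+2$. Below, for given $m$ with $1\leq m\leq n+1$, $l$ is defined by $l+m-2=n$. There exist coprime polynomials $A_1 , A_2 \in \mathbb{F}_q[T]$ with $\deg A_1 = \rho_1$ and $\deg A_2 \leq c_2$ such that $$\ker H_{l,m} (\boldsymbol{\alpha}) = \begin{cases} \{ \mathbf{0} \} & \text{if } 1 \leq m \leq c_1, \\ \{ B_1 A_1 : B_1 \in \mathbb{F}_q[T],\ \deg B_1 \leq m - c_1 - 1 \} & \text{if } c_1 + 1 \leq m \leq c_2, \\ \{ B_1 A_1 + B_2 A_2 : B_1,B_2 \in \mathbb{F}_q[T],\ \deg B_1 \leq m - c_1 - 1,\ \deg B_2 \leq m - c_2 - 1 \} & \text{if } c_2 +1 \leq m \leq n+1, \end{cases}$$ as subspaces of $\mathbb{F}_q^m$. If $\rho_1 \neq r$, then necessarily $\deg A_2 = c_2$. If $r \in \{0,1\}$, this simplifies to $$\ker H_{l,m} (\boldsymbol{\alpha}) = \begin{cases} \{ \mathbf{0} \} & \text{if } 1 \leq m \leq c_1, \\ \{ B_1 A_1 : B_1 \in \mathbb{F}_q[T],\ \deg B_1 \leq m - c_1 - 1 \} & \text{if } c_1 + 1 \leq m \leq n+1, \end{cases}$$ and in this case $A_2$ is by definition taken to be $$A_2 := \begin{cases} 0 & \text{if } \boldsymbol{\alpha} \in \mathcal{L}_n (0 , 0 , 0 ) \text{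 (i.e. } \boldsymbol{\alpha}= \mathbf{0}), \\ 1 & \text{if } \boldsymbol{\alpha} \in \mathcal{L}_n (1 , 1 , 0 ), \\ T^{n+1} & \text{if } \boldsymbol{\alpha} \in \mathcal{L}_n (1 , 0 , 1 ). \end{cases}$$
   Context: For an integer $n\ge 0$ put $n_1 := \lfloor \frac{n+2}{2} \rfloor$ and $n_2 := \lfloor \frac{n+3}{2} \rfloor$. For $\boldsymbol{\alpha}=(\alpha_0,\ldots,\alpha_n) \in \mathbb{F}_q^{n+1}$ and $l,m \geq 1$ with $l+m-2 \leq n$, $H_{l,m}(\boldsymbol{\alpha})$ denotes the $l\times m$ Hankel matrix $(\alpha_{i+j-2})_{1\leq i\leq l,\,1\leq j\leq m}$. $\rho(\boldsymbol{\alpha})$ is the largest $l \in \{1,\ldots,n_1\}$ with $\det H_{l,l}(\boldsymbol{\alpha}) \neq 0$, or $0$ if there is no such $l$; and $\pi(\boldsymbol{\alpha}) := \operatorname{rank} H_{n_1,n_2}(\boldsymbol{\alpha}) - \rho(\boldsymbol{\alpha})$. $\mathcal{L}_n(r,\rho_1,\pi_1)$ is the set of $\boldsymbol{\alpha}\in\mathbb{F}_q^{n+1}$ with $\operatorname{rank} H_{n_1,n_2}(\boldsymbol{\alpha})=r$, $\rho(\boldsymbol{\alpha})=\rho_1$, $\pi(\boldsymbol{\alpha})=\pi_1$ (so $r=\rho_1+\pi_1$). Vectors are identified with polynomials: $(v_0,\ldots,v_{m-1})^T\in\mathbb{F}_q^m$ is identified with $v_0+v_1T+\cdots+v_{m-1}T^{m-1}$;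 thus $\mathbb{F}_q^m$ is identified with the polynomials of degree $\leq m-1$. Convention: $\deg 0=-\infty$, so degree bounds on $B_1,B_2$ allow the zero polynomial. *)

theory Defs
  imports
    "Jordan_Normal_Form.Determinant"
    "Jordan_Normal_Form.Matrix_Kernel"
    "Jordan_Normal_Form.DL_Rank"
begin

(* Matrices and vectors are indexed from 0, so the (i,j) entry is alpha_(i+j).
   The definition is meant for l + m - 2 <= n where dim_vec alpha = n + 1. *)
definition hankel_mat :: "'a vec \<Rightarrow> nat \<Rightarrow> nat \<Rightarrow> 'a mat" where
  "hankel_mat \<alpha> l m = mat l m (\<lambda>(i, j). \<alpha> $ (i + j))"

definition hankel_n1 :: "nat \<Rightarrow> nat" where
  "hankel_n1 n = (n + 2) div 2"

definition hankel_n2 :: "nat \<Rightarrow> nat" where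
  "hankel_n2 n = (n + 3) div 2"

definition hankel_rank :: "nat \<Rightarrow> 'a::field vec \<Rightarrow> nat" where
  "hankel_rank n \<alpha> =
     vec_space.rank (hankel_n1 n) (hankel_mat \<alpha> (hankel_n1 n) (hankel_n2 n))"

definition hankel_rho :: "nat \<Rightarrow> 'a::field vec \<Rightarrow> nat" where
  "hankel_rho n \<alpha> =
     (if \<exists>l\<in>{1..hankel_n1 n}. det (hankel_mat \<alpha> l l) \<noteq> 0
      then Max {l \<in> {1..hankel_n1 n}. det (hankel_mat \<alpha> l l) \<noteq> 0}
      else 0)"

(* The subtraction never truncates: a nonsingular leading block of size rho
   forces the rank to be at least rho. *)
definition hankel_pi :: "nat \<Rightarrow> 'a::field vec \<Rightarrow> nat" where
  "hankel_pi n \<alpha> = hankel_rank n \<alpha> - hankel_rho n \<alpha>"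

definition hankel_L :: "nat \<Rightarrow> nat \<Rightarrow> nat \<Rightarrow> nat \<Rightarrow> 'a::field vec set" where
  "hankel_L n r \<rho>\<^sub>1 \<pi>\<^sub>1 =
     {\<alpha> \<in> carrier_vec (n + 1).
        hankel_rank n \<alpha> = r \<and> hankel_rho n \<alpha> = \<rho>\<^sub>1 \<and> hankel_pi n \<alpha> = \<pi>\<^sub>1}"

definition poly_of_vec :: "'a::zero vec \<Rightarrow> 'a poly" where
  "poly_of_vec v = Poly (list_of_vec v)"

(* The kernel of the l x m Hankel matrix with l + m - 2 = n, under the
   identification of vectors of length m with polynomials of degree < m.
   That identification is injective on carrier_vec m, so equalities between
   such images are equalities of subspaces. *)
definition hankel_ker :: "nat \<Rightarrow> 'a::comm_ring_1 vec \<Rightarrow> nat \<Rightarrow> 'a poly set" where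
  "hankel_ker n \<alpha> m = poly_of_vec ` mat_kernel (hankel_mat \<alpha> (n + 2 - m) m)"

(* degree 0 = 0 in the library, so "degree B <= d" admits the zero polynomial,
   whereas "deg A1 = rho" has to exclude it explicitly. *)
definition hankel_poly_pair ::
    "nat \<Rightarrow> 'a::field vec \<Rightarrow> nat \<Rightarrow> nat \<Rightarrow> nat \<Rightarrow> 'a poly \<Rightarrow> 'a poly \<Rightarrow> bool" where
  "hankel_poly_pair n \<alpha> \<rho>\<^sub>1 c\<^sub>1 c\<^sub>2 A\<^sub>1 A\<^sub>2 \<longleftrightarrow>
     coprime A\<^sub>1 A\<^sub>2 \<and>
     A\<^sub>1 \<noteq> 0 \<and> degree A\<^sub>1 = \<rho>\<^sub>1 \<and>
     degree A\<^sub>2 \<le> c\<^sub>2 \<and>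
     (\<forall>m\<in>{1..n + 1}.
        (m \<le> c\<^sub>1 \<longrightarrow> hankel_ker n \<alpha> m = {0}) \<and>
        (c\<^sub>1 + 1 \<le> m \<and> m \<le> c\<^sub>2 \<longrightarrow>
           hankel_ker n \<alpha> m = {B\<^sub>1 * A\<^sub>1 | B\<^sub>1. degree B\<^sub>1 \<le> m - c\<^sub>1 - 1}) \<and>
        (c\<^sub>2 + 1 \<le> m \<longrightarrow>
           hankel_ker n \<alpha> m =
             {B\<^sub>1 * A\<^sub>1 + B\<^sub>2 * A\<^sub>2 | B\<^sub>1 B\<^sub>2.
                degree B\<^sub>1 \<le> m - c\<^sub>1 - 1 \<and> degree B\<^sub>2 \<le> m - c\<^sub>2 - 1}))"

(* For rank 0 or 1 the kernels do not involve A2, which is then fixed by convention. *)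
definition hankel_A2_convention :: "nat \<Rightarrow> 'a::field vec \<Rightarrow> 'a poly \<Rightarrow> bool" where
  "hankel_A2_convention n \<alpha> A\<^sub>2 \<longleftrightarrow>
     (\<alpha> \<in> hankel_L n 0 0 0 \<longrightarrow> A\<^sub>2 = 0) \<and>
     (\<alpha> \<in> hankel_L n 1 1 0 \<longrightarrow> A\<^sub>2 = 1) \<and>
     (\<alpha> \<in> hankel_L n 1 0 1 \<longrightarrow> A\<^sub>2 = monom 1 (n + 1))"

end

theory Submission
  imports Defs
begin

text \<open>
Read a vector \<open>v\<close> as a polynomial \<open>p\<close> and let \<open>b\<close> be the polynomial in which the coefficient of
\<open>T ^ (n + 1 - i)\<close> is the \<open>i\<close>-th entry of \<open>\<alpha>\<close>. The equations \<open>H v = 0\<close> then say that some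
coefficients of \<open>p * b\<close> vanish, and for the Hankel matrix with \<open>m\<close> columns and \<open>n + 2 - m\<close> rows they
become the symmetric condition that both \<open>p\<close> and \<open>u = p * b mod T ^ (n + 2)\<close> have degree at most
\<open>m - 1\<close> (\<open>hankel_ker_eq\<close>). All the kernels are thus the balls, with respect to the larger of the two
degrees, of one lattice: the module \<open>L\<close> of all \<open>(p, u)\<close> with \<open>u \<equiv> p * b\<close> modulo \<open>T ^ (n + 2)\<close>,
which has rank 2 and determinant \<open>T ^ (n + 2)\<close>.

Lattice reduction produces a basis \<open>(p1, u1)\<close>, \<open>(p2, u2)\<close> of \<open>L\<close> whose sizes \<open>d1 \<le> d2\<close> add up to
the degree \<open>n + 2\<close> of the determinant (\<open>ex_reduced_basis\<close>). Cramer's rule shows that in the expansion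
\<open>p = B1 * p1 + B2 * p2\<close> no leading terms cancel (\<open>expansion\<close>), so the ball of radius \<open>m - 1\<close> is described by
\<open>degree B1 + d1 \<le> m - 1\<close> and \<open>degree B2 + d2 \<le> m - 1\<close>. This is the claimed shape of the kernels,
with \<open>A1 = p1\<close>, \<open>A2 = p2\<close> and the bounds \<open>d1\<close>, \<open>d2\<close>. Coprimality comes from expanding \<open>(1, b) \<in> L\<close>.

It remains to recognise the invariants. The kernel of the most nearly square Hankel matrix has
dimension \<open>n2 - d1\<close>, so the rank \<open>r\<close> is \<open>d1\<close> and \<open>n - r + 2\<close> is \<open>d2\<close> (\<open>hankel_rank_eq\<close>). A leading principal
minor of order \<open>l\<close> vanishes iff \<open>L\<close> contains an element with \<open>p \<noteq> 0\<close>, \<open>degree p < l\<close> and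
\<open>degree u \<le> n + 1 - l\<close>; for \<open>l > degree p1\<close> the first basis element is one, while for
\<open>l = degree p1\<close> Cramer's rule excludes it, so \<open>\<rho> = degree p1\<close> (\<open>hankel_rho_eq\<close>). Finally, the leading
vectors of a reduced basis are independent, so \<open>degree p1 < d1\<close> forces \<open>degree p2 = d2\<close>.
\<close>

section \<open>Reduced bases of congruence lattices\<close>

text \<open>A module of rank two over the polynomials whose small elements \<open>(p, u)\<close> are the Pade
approximants \<open>u / p\<close> of \<open>b\<close> modulo \<open>T ^ N\<close>. The size of an element is the larger of the degrees
of \<open>p\<close> and \<open>u\<close>.\<close>

definition congruence_lattice :: "'a::field poly \<Rightarrow> nat \<Rightarrow> ('a poly \<times> 'a poly) set" where
  "congruence_lattice b N = {(p, u). monom 1 N dvd u - p * b}"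

lemma congruence_lattice_combine:
  assumes "(p, u) \<in> congruence_lattice b N" "(q, w) \<in> congruence_lattice b N"
  shows "(f * p + g * q, f * u + g * w) \<in> congruence_lattice b N"
proof -
  have "f * u + g * w - (f * p + g * q) * b = f * (u - p * b) + g * (w - q * b)"
    by (simp add: algebra_simps)
  with assms show ?thesis
    unfolding congruence_lattice_def by (auto intro!: dvd_add dvd_mult)
qed

lemma coeff_mult_at_degree_bounds:
  fixes p q :: "'a::comm_semiring_1 poly"
  assumes "degree p \<le> d" "degree q \<le> e"
  shows "coeff (p * q) (d + e) = coeff p d * coeff q e"
proof (cases "degree p = d \<and> degree q = e")
  case True
  then show ?thesis using coeff_mult_degree_sum by blast
next
  case False
  with assms have lt: "degree p < d \<or> degree q < e" by auto
  with assms have "degree p + degree q < d + e" by linarith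
  then have "degree (p * q) < d + e" using degree_mult_le[of p q] by linarith
  then have "coeff (p * q) (d + e) = 0" by (rule coeff_eq_0)
  moreover have "coeff p d = 0 \<or> coeff q e = 0" using lt coeff_eq_0 by blast
  ultimately show ?thesis by auto
qed

lemma degree_monom_mult_bound:
  fixes B :: "'a::idom poly"
  assumes "degree (monom 1 N * B) \<le> k"
  shows "B = 0 \<or> N + degree B \<le> k"
proof (cases "B = 0")
  case False
  then have "degree (monom 1 N * B) = N + degree B"
    by (subst degree_mult_eq) (auto simp: degree_monom_eq)
  with assms show ?thesis by simp
qed simp

text \<open>Being a basis is expressed by the determinant alone: the determinant of any two elements of the
lattice is a multiple of \<open>T ^ N\<close>, so Cramer's rule expands every element in a pair of determinant
exactly \<open>T ^ N\<close>. The numbers \<open>d1\<close> and \<open>d2\<close> are only upper bounds for the sizes, which keeps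
the zero polynomial from needing separate treatment.\<close>

locale lattice_basis =
  fixes b :: "'a::field poly" and N d1 d2 :: nat and p1 u1 p2 u2 :: "'a poly"
  assumes mem1: "(p1, u1) \<in> congruence_lattice b N"
    and mem2: "(p2, u2) \<in> congruence_lattice b N"
    and det: "p1 * u2 - p2 * u1 = monom 1 N"
    and deg1: "degree p1 \<le> d1" "degree u1 \<le> d1"
    and deg2: "degree p2 \<le> d2" "degree u2 \<le> d2"
begin

lemma coeff_det:
  "coeff (monom (1::'a) N) (d1 + d2) = coeff p1 d1 * coeff u2 d2 - coeff p2 d2 * coeff u1 d1"
  using coeff_mult_at_degree_bounds[OF deg1(1) deg2(2)]
    coeff_mult_at_degree_bounds[OF deg2(1) deg1(2)]
  by (simp add: det[symmetric] add.commute)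

lemma degree_sum_ge: "N \<le> d1 + d2"
proof -
  have "degree (p1 * u2) \<le> d1 + d2" "degree (p2 * u1) \<le> d1 + d2"
    using degree_mult_le[of p1 u2] degree_mult_le[of p2 u1] deg1 deg2 by linarith+
  then have "degree (monom (1::'a) N) \<le> d1 + d2"
    unfolding det[symmetric] by (rule degree_diff_le)
  then show ?thesis by (simp add: degree_monom_eq)
qed

lemma swap: "lattice_basis b N d2 d1 p2 u2 (- p1) (- u1)"
proof
  show "(- p1, - u1) \<in> congruence_lattice b N"
    using congruence_lattice_combine[OF mem1 mem1, of "-1" 0] by simp
  show "p2 * (- u1) - (- p1) * u2 = monom 1 N" using det by (simp add: algebra_simps)
qed (use deg1 deg2 mem2 in auto)

text \<open>The coefficient of \<open>T ^ (d1 + d2)\<close> in the determinant is the determinant of the two leading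
vectors. If \<open>d1 + d2\<close> exceeds \<open>N\<close> it vanishes, so either the first leading vector is zero and \<open>d1\<close>
was not sharp, or the second one is a multiple of the first and a shifted multiple of the first
basis element cancels it.\<close>

lemma reduction_step:
  assumes le: "d1 \<le> d2" and gt: "N < d1 + d2"
  shows "\<exists>e1 e2 q1 w1 q2 w2. lattice_basis b N e1 e2 q1 w1 q2 w2 \<and> e1 + e2 < d1 + d2"
proof (cases "coeff p1 d1 = 0 \<and> coeff u1 d1 = 0")
  case True
  have "d1 > 0"
  proof (rule ccontr)
    assume "\<not> 0 < d1"
    then have "d1 = 0" by simp
    with True deg1 have "p1 = 0" "u1 = 0"
      using leading_coeff_0_iff by (metis le_zero_eq)+
    then have "monom (1::'a) N = 0" using det by simp
    then show False by simp
  qed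
  have "degree p1 \<le> d1 - 1" "degree u1 \<le> d1 - 1"
    using True deg1 coeff_0_degree_minus_1 by blast+
  then have "lattice_basis b N (d1 - 1) d2 p1 u1 p2 u2"
    using mem1 mem2 det deg2 by unfold_locales auto
  with \<open>d1 > 0\<close> show ?thesis by (intro exI conjI) auto
next
  case False
  have zero: "coeff p1 d1 * coeff u2 d2 = coeff p2 d2 * coeff u1 d1"
    using coeff_det gt by (simp add: eq_diff_eq)
  obtain c where c: "coeff p2 d2 = c * coeff p1 d1" "coeff u2 d2 = c * coeff u1 d1"
  proof (cases "coeff p1 d1 = 0")
    case True
    with False have "coeff u1 d1 \<noteq> 0" by simp
    with True zero show ?thesis
      by (intro that[of "coeff u2 d2 / coeff u1 d1"]) auto
  next
    case nz: False
    with zero show ?thesis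
      by (intro that[of "coeff p2 d2 / coeff p1 d1"]) (auto simp: field_simps)
  qed
  define t where "t = monom c (d2 - d1)"
  have t: "degree t \<le> d2 - d1" "coeff t (d2 - d1) = c"
    by (auto simp: t_def degree_monom_le)
  have shifted: "degree (x2 - t * x1) \<le> d2 - 1"
    if "degree x1 \<le> d1" "degree x2 \<le> d2" "coeff x2 d2 = c * coeff x1 d1" for x1 x2
  proof (rule coeff_0_degree_minus_1)
    show "coeff (x2 - t * x1) d2 = 0"
      using coeff_mult_at_degree_bounds[OF t(1) that(1)] that(3) le t(2) by simp
    have "degree (t * x1) \<le> d2"
      using degree_mult_le[of t x1] t(1) that(1) le by linarith
    with that(2) show "degree (x2 - t * x1) \<le> d2" by (rule degree_diff_le)
  qed
  have "lattice_basis b N d1 (d2 - 1) p1 u1 (p2 - t * p1) (u2 - t * u1)"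
  proof
    show "(p2 - t * p1, u2 - t * u1) \<in> congruence_lattice b N"
      using congruence_lattice_combine[OF mem1 mem2, of "- t" 1] by simp
    show "p1 * (u2 - t * u1) - (p2 - t * p1) * u1 = monom 1 N"
      using det by (simp add: algebra_simps)
    show "degree (p2 - t * p1) \<le> d2 - 1" "degree (u2 - t * u1) \<le> d2 - 1"
      using shifted deg1 deg2 c by blast+
  qed (use mem1 deg1 in auto)
  moreover have "d1 + (d2 - 1) < d1 + d2" using gt le by linarith
  ultimately show ?thesis by blast
qed

end

text \<open>The equality \<open>d1 + d2 = N\<close> makes \<open>d1\<close> and \<open>d2\<close> the successive minima of the lattice. In case of
a tie the two elements can be exchanged; choosing as first the one whose \<open>p\<close>-component has full
degree is what makes \<open>degree p1\<close> an invariant of the lattice.\<close>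

locale reduced_basis = lattice_basis +
  assumes degree_sum: "d1 + d2 = N"
    and degree_le: "d1 \<le> d2"
    and degree_tie: "d1 = d2 \<Longrightarrow> degree p1 = d1"

lemma (in lattice_basis) ex_minimal_basis:
  "\<exists>e1 e2 q1 w1 q2 w2. lattice_basis b N e1 e2 q1 w1 q2 w2 \<and> e1 + e2 = N"
  using lattice_basis_axioms
proof (induction "d1 + d2" arbitrary: d1 d2 p1 u1 p2 u2 rule: less_induct)
  case less
  interpret B: lattice_basis b N d1 d2 p1 u1 p2 u2 by (rule less.prems)
  interpret S: lattice_basis b N d2 d1 p2 u2 "- p1" "- u1" by (rule B.swap)
  show ?case
  proof (cases "d1 + d2 = N")
    case True
    then show ?thesis using less.prems by blast
  next
    case False
    with B.degree_sum_ge have "N < d1 + d2" by simp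
    then obtain e1 e2 q1 w1 q2 w2 where
      "lattice_basis b N e1 e2 q1 w1 q2 w2" "e1 + e2 < d1 + d2"
      using B.reduction_step S.reduction_step by (metis add.commute le_cases)
    then show ?thesis using less.hyps by blast
  qed
qed

text \<open>The reduction starts from the obvious basis \<open>(1, b)\<close>, \<open>(0, T ^ N)\<close>. At the end the two leading
vectors have determinant 1, so at least one of the two \<open>p\<close>-components attains its degree bound;
this is what permits the choice in a tie.\<close>

lemma ex_reduced_basis:
  fixes b :: "'a::field poly"
  shows "\<exists>d1 d2 p1 u1 p2 u2. reduced_basis b N d1 d2 p1 u1 p2 u2"
proof -
  interpret I: lattice_basis b N "degree b" N 1 b 0 "monom 1 N"
    by unfold_locales (auto simp: congruence_lattice_def degree_monom_le)
  obtain d1 d2 p1 u1 p2 u2 where "lattice_basis b N d1 d2 p1 u1 p2 u2" and sum: "d1 + d2 = N"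
    using I.ex_minimal_basis by blast
  then interpret B: lattice_basis b N d1 d2 p1 u1 p2 u2 by simp
  interpret S: lattice_basis b N d2 d1 p2 u2 "- p1" "- u1" by (rule B.swap)
  have "coeff p1 d1 * coeff u2 d2 - coeff p2 d2 * coeff u1 d1 = 1"
    using B.coeff_det sum by simp
  then have "coeff p1 d1 \<noteq> 0 \<or> coeff p2 d2 \<noteq> 0" by auto
  then have top: "degree p1 = d1 \<or> degree p2 = d2"
    using B.deg1(1) B.deg2(1) le_degree le_antisym by blast
  show ?thesis
  proof (cases "d1 < d2 \<or> (d1 = d2 \<and> degree p1 = d1)")
    case True
    then have "reduced_basis b N d1 d2 p1 u1 p2 u2"
      using sum by unfold_locales auto
    then show ?thesis by blast
  next
    case False
    with top sum have "reduced_basis b N d2 d1 p2 u2 (- p1) (- u1)"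
      by unfold_locales auto
    then show ?thesis by blast
  qed
qed

context reduced_basis
begin

lemma degree_p2:
  assumes "degree p1 \<noteq> d1"
  shows "degree p2 = d2"
proof -
  have "coeff p1 d1 = 0" using assms deg1(1) by (simp add: coeff_eq_0)
  then have "coeff p2 d2 \<noteq> 0" using coeff_det degree_sum by auto
  then show ?thesis using deg2(1) le_degree le_antisym by blast
qed

lemma cramer:
  assumes "(p, u) \<in> congruence_lattice b N"
  obtains B1 B2 where "p = B1 * p1 + B2 * p2" "u = B1 * u1 + B2 * u2"
    "monom 1 N * B1 = p * u2 - u * p2" "monom 1 N * B2 = p1 * u - u1 * p"
proof -
  have cross: "monom 1 N dvd q * w' - w * q'"
    if "(q, w) \<in> congruence_lattice b N" "(q', w') \<in> congruence_lattice b N" for q w q' w'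
  proof -
    have "q * w' - w * q' = q * (w' - q' * b) - q' * (w - q * b)"
      by (simp add: algebra_simps)
    with that show ?thesis unfolding congruence_lattice_def by (auto intro!: dvd_diff dvd_mult)
  qed
  obtain B1 where B1: "p * u2 - u * p2 = monom 1 N * B1"
    using cross[OF assms mem2] by blast
  obtain B2 where B2: "p1 * u - u1 * p = monom 1 N * B2"
    using cross[OF mem1 assms] by blast
  have "monom 1 N * p = p1 * (p * u2 - u * p2) + p2 * (p1 * u - u1 * p)"
    unfolding det[symmetric] by (simp add: algebra_simps)
  also have "\<dots> = monom 1 N * (B1 * p1 + B2 * p2)"
    unfolding B1 B2 by (simp add: algebra_simps)
  finally have p: "p = B1 * p1 + B2 * p2" by simp
  have "monom 1 N * u = u1 * (p * u2 - u * p2) + u2 * (p1 * u - u1 * p)"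
    unfolding det[symmetric] by (simp add: algebra_simps)
  also have "\<dots> = monom 1 N * (B1 * u1 + B2 * u2)"
    unfolding B1 B2 by (simp add: algebra_simps)
  finally have u: "u = B1 * u1 + B2 * u2" by simp
  show thesis using that p u B1 B2 by metis
qed

text \<open>This is where the basis being reduced matters: in Cramer's rule the numerator of \<open>B1\<close> has degree at
most \<open>k + d2\<close> and the denominator has degree exactly \<open>d1 + d2\<close>, and likewise for \<open>B2\<close>.\<close>

lemma expansion:
  assumes "(p, u) \<in> congruence_lattice b N" "degree p \<le> k" "degree u \<le> k"
  obtains B1 B2 where "p = B1 * p1 + B2 * p2" "u = B1 * u1 + B2 * u2"
    "B1 = 0 \<or> degree B1 + d1 \<le> k" "B2 = 0 \<or> degree B2 + d2 \<le> k"
proof -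
  obtain B1 B2 where B: "p = B1 * p1 + B2 * p2" "u = B1 * u1 + B2 * u2"
    "monom 1 N * B1 = p * u2 - u * p2" "monom 1 N * B2 = p1 * u - u1 * p"
    by (rule cramer[OF assms(1)])
  have "degree (p * u2) \<le> k + d2" "degree (u * p2) \<le> k + d2"
    "degree (p1 * u) \<le> k + d1" "degree (u1 * p) \<le> k + d1"
    using assms(2,3) deg1 deg2 degree_mult_le[of p u2] degree_mult_le[of u p2]
      degree_mult_le[of p1 u] degree_mult_le[of u1 p] by linarith+
  then have "degree (monom 1 N * B1) \<le> k + d2" "degree (monom 1 N * B2) \<le> k + d1"
    unfolding B(3,4) by (auto intro: degree_diff_le)
  then have "B1 = 0 \<or> degree B1 + d1 \<le> k" "B2 = 0 \<or> degree B2 + d2 \<le> k"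
    using degree_monom_mult_bound degree_sum by fastforce+
  with B that show thesis by blast
qed

text \<open>The element \<open>(1, b)\<close> of the lattice expands in the basis, and its first component is a Bezout
identity.\<close>

lemma coprime_generators: "coprime p1 p2"
proof -
  have "(1, b) \<in> congruence_lattice b N" by (simp add: congruence_lattice_def)
  then obtain B1 B2 where "1 = B1 * p1 + B2 * p2" by (rule cramer)
  then show ?thesis by (metis coprimeI dvd_add dvd_mult)
qed

lemma p1_nonzero:
  assumes "N > 0"
  shows "p1 \<noteq> 0"
proof
  assume "p1 = 0"
  have "degree u1 < N"
    using deg1(2) degree_sum degree_le assms by linarith
  moreover have "monom 1 N dvd u1"
    using mem1 \<open>p1 = 0\<close> by (simp add: congruence_lattice_def)
  ultimately have "u1 = 0"
    using dvd_imp_degree_le[of "monom (1::'a) N" u1] by (auto simp: degree_monom_eq)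
  with det \<open>p1 = 0\<close> have "monom (1::'a) N = 0" by simp
  then show False by simp
qed

lemma bounded_elements_eq:
  assumes "k < N"
  shows "{p. degree p \<le> k \<and> (\<exists>u. (p, u) \<in> congruence_lattice b N \<and> degree u \<le> k)} =
    {B1 * p1 + B2 * p2 | B1 B2. (B1 = 0 \<or> degree B1 + d1 \<le> k) \<and> (B2 = 0 \<or> degree B2 + d2 \<le> k)}"
    (is "?K = ?S")
proof
  show "?K \<subseteq> ?S" by (auto elim!: expansion)
  show "?S \<subseteq> ?K"
  proof clarify
    fix B1 B2 :: "'a poly"
    assume B: "B1 = 0 \<or> degree B1 + d1 \<le> k" "B2 = 0 \<or> degree B2 + d2 \<le> k"
    have bound: "degree (B1 * x + B2 * y) \<le> k" if "degree x \<le> d1" "degree y \<le> d2" for x y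
    proof (rule degree_add_le)
      show "degree (B1 * x) \<le> k" using B(1) that(1) degree_mult_le[of B1 x] by force
      show "degree (B2 * y) \<le> k" using B(2) that(2) degree_mult_le[of B2 y] by force
    qed
    show "degree (B1 * p1 + B2 * p2) \<le> k \<and>
      (\<exists>u. (B1 * p1 + B2 * p2, u) \<in> congruence_lattice b N \<and> degree u \<le> k)"
      using bound deg1 deg2 congruence_lattice_combine[OF mem1 mem2] by blast
  qed
qed

end

section \<open>The rank of a matrix with a parametrised kernel\<close>

lemma mult_mat_vec_linear_map:
  fixes A :: "'a::field mat"
  assumes A: "A \<in> carrier_mat nr nc"
  shows "linear_map class_ring (module_vec TYPE('a) nc) (module_vec TYPE('a) nr) ((*\<^sub>v) A)"
proof -
  have "(*\<^sub>v) A \<in> LinearCombinations.module_hom class_ring (module_vec TYPE('a) nc) (module_vec TYPE('a) nr)"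
    using mult_mat_vec_carrier[OF A] mult_add_distrib_mat_vec[OF A] mult_mat_vec[OF A]
    unfolding LinearCombinations.module_hom_def module_vec_simps by simp
  then show ?thesis
    by (intro linear_map.intro mod_hom.intro mod_hom_axioms.intro vec_vs vec_module)
qed

lemma rank_plus_dim_kernel:
  fixes A :: "'a::field mat"
  assumes A: "A \<in> carrier_mat nr nc"
  shows "vec_space.rank nr A +
    vectorspace.dim class_ring ((module_vec TYPE('a) nc)\<lparr>carrier := mat_kernel A\<rparr>) = nc"
proof -
  interpret D: vec_space "TYPE('a)" nc .
  interpret R: vec_space "TYPE('a)" nr .
  interpret T: linear_map class_ring "module_vec TYPE('a) nc" "module_vec TYPE('a) nr" "(*\<^sub>v) A"
    by (rule mult_mat_vec_linear_map[OF A])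
  have "T.kerT = mat_kernel A"
    unfolding T.ker_def mat_kernel[OF A] by (auto simp: module_vec_simps)
  moreover have "T.imT = R.span (set (cols A))"
    using R.col_space_eq[OF A] A unfolding T.im_def R.col_space_def
    by (auto simp: module_vec_simps)
  ultimately show ?thesis
    using T.rank_nullity D.fin_dim D.dim_is_n unfolding R.rank_def by simp
qed

text \<open>Rank-nullity is applied twice: for \<open>A\<close>, and for an injective parametrisation \<open>C\<close> of the kernel of
\<open>A\<close>, whose rank is the dimension of that kernel.\<close>

lemma rank_of_exact_sequence:
  fixes A C :: "'a::field mat"
  assumes A: "A \<in> carrier_mat nr nc" and C: "C \<in> carrier_mat nc k"
    and inj: "mat_kernel C = {0\<^sub>v k}"
    and exact: "mat_kernel A = (*\<^sub>v) C ` carrier_vec k"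
  shows "vec_space.rank nr A + k = nc"
proof -
  interpret K: vec_space "TYPE('a)" k .
  interpret D: vec_space "TYPE('a)" nc .
  have "D.span (set (cols C)) = (*\<^sub>v) C ` carrier_vec k"
    using D.col_space_eq[OF C] C mult_mat_vec_carrier[OF C] unfolding D.col_space_def
    by (simp only: carrier_matD[OF C]) blast
  then have "D.span (set (cols C)) = mat_kernel A"
    using exact by simp
  then have "vectorspace.dim class_ring ((module_vec TYPE('a) nc)\<lparr>carrier := mat_kernel A\<rparr>) =
      vec_space.rank nc C"
    unfolding D.rank_def by simp
  moreover have "vectorspace.dim class_ring ((module_vec TYPE('a) k)\<lparr>carrier := mat_kernel C\<rparr>) = 0"
  proof -
    interpret T: linear_map class_ring "module_vec TYPE('a) k" "module_vec TYPE('a) nc" "(*\<^sub>v) C"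
      by (rule mult_mat_vec_linear_map[OF C])
    have ker: "T.kerT = mat_kernel C"
      unfolding T.ker_def mat_kernel[OF C] by (auto simp: module_vec_simps)
    have "inj_on ((*\<^sub>v) C) (carrier (module_vec TYPE('a) k))"
      by (rule T.Ke0_imp_inj) (simp add: ker inj module_vec_simps)
    then show ?thesis using T.inj_imp_dim_ker0 ker by simp
  qed
  ultimately show ?thesis
    using rank_plus_dim_kernel[OF A] rank_plus_dim_kernel[OF C] by simp
qed

section \<open>Vectors as polynomials\<close>

lemma coeff_poly_of_vec:
  "coeff (poly_of_vec v) k = (if k < dim_vec v then v $ k else 0)"
  unfolding poly_of_vec_def by (simp add: nth_default_def)

lemma degree_poly_of_vec:
  assumes "v \<in> carrier_vec m" "m > 0"
  shows "degree (poly_of_vec v) \<le> m - 1"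
  by (rule degree_le) (use assms in \<open>auto simp: coeff_poly_of_vec\<close>)

lemma poly_of_vec_coeff:
  assumes "degree p < m"
  shows "poly_of_vec (vec m (coeff p)) = p"
  using assms by (intro poly_eqI) (auto simp: coeff_poly_of_vec coeff_eq_0)

lemma poly_of_vec_eq_0_iff:
  assumes "v \<in> carrier_vec m"
  shows "poly_of_vec v = 0 \<longleftrightarrow> v = 0\<^sub>v m"
proof
  assume "poly_of_vec v = 0"
  then have "v $ k = 0" if "k < m" for k
    using coeff_poly_of_vec[of v k] that assms by simp
  with assms show "v = 0\<^sub>v m" by auto
qed (use assms in \<open>auto intro!: poly_eqI simp: coeff_poly_of_vec\<close>)

lemma coeff_poly_of_vec_mult:
  assumes "v \<in> carrier_vec m"
  shows "coeff (poly_of_vec v * q) j = (\<Sum>k<m. if k \<le> j then v $ k * coeff q (j - k) else 0)"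
proof -
  have "coeff (poly_of_vec v * q) j = (\<Sum>k\<in>{..j}. coeff (poly_of_vec v) k * coeff q (j - k))"
    by (rule coeff_mult)
  also have "\<dots> = (\<Sum>k\<in>{..j} \<inter> {..<m}. v $ k * coeff q (j - k))"
    using assms by (intro sum.mono_neutral_cong_right) (auto simp: coeff_poly_of_vec)
  also have "\<dots> = (\<Sum>k<m. if k \<le> j then v $ k * coeff q (j - k) else 0)"
    by (subst Int_commute, subst sum.inter_restrict) (auto intro!: sum.cong)
  finally show ?thesis .
qed

lemma poly_of_vec_inj:
  assumes "v \<in> carrier_vec m" "w \<in> carrier_vec m" "poly_of_vec v = poly_of_vec w"
  shows "v = w"
proof (rule eq_vecI)
  fix i assume "i < dim_vec w"
  then show "v $ i = w $ i"
    using assms coeff_poly_of_vec[of v i] coeff_poly_of_vec[of w i] by simp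
qed (use assms in auto)

text \<open>The matrix of multiplication by \<open>q\<close> from polynomials of degree below \<open>k\<close> to polynomials of degree
below \<open>m\<close>.\<close>

definition convolution_mat :: "'a::field poly \<Rightarrow> nat \<Rightarrow> nat \<Rightarrow> 'a mat" where
  "convolution_mat q m k = mat m k (\<lambda>(i, j). if j \<le> i then coeff q (i - j) else 0)"

lemma convolution_mat_carrier: "convolution_mat q m k \<in> carrier_mat m k"
  by (simp add: convolution_mat_def)

lemma poly_of_convolution_mat_mult:
  assumes x: "x \<in> carrier_vec k" and deg: "degree (poly_of_vec x * q) < m"
  shows "poly_of_vec (convolution_mat q m k *\<^sub>v x) = poly_of_vec x * q"
proof -
  have "(convolution_mat q m k *\<^sub>v x) $ i = coeff (poly_of_vec x * q) i" if "i < m" for i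
    unfolding coeff_poly_of_vec_mult[OF x]
    using x that by (auto simp: convolution_mat_def scalar_prod_def lessThan_atLeast0 mult.commute
        intro!: sum.cong)
  then have "convolution_mat q m k *\<^sub>v x = vec m (coeff (poly_of_vec x * q))"
    by (intro eq_vecI) (auto simp: convolution_mat_def)
  then show ?thesis using poly_of_vec_coeff[OF deg] by simp
qed

section \<open>Hankel kernels as balls in a lattice\<close>

text \<open>The sequence is written in reverse order and shifted by one. Reversal turns the correlation sums
of a Hankel matrix into convolution sums, that is, into coefficients of a product of polynomials.
The shift by one makes the size bounds on both components of a lattice element agree: with it,
the kernel of the Hankel matrix with \<open>m\<close> columns and \<open>n + 2 - m\<close> rows consists of the first
components of the lattice elements of size below \<open>m\<close>.\<close>

definition hankel_symbol :: "nat \<Rightarrow> 'a::field vec \<Rightarrow> 'a poly" where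
  "hankel_symbol n \<alpha> = (\<Sum>i\<le>n. monom (\<alpha> $ i) (n + 1 - i))"

lemma coeff_hankel_symbol:
  assumes "i \<le> n"
  shows "coeff (hankel_symbol n \<alpha>) (n + 1 - i) = \<alpha> $ i"
proof -
  have "coeff (hankel_symbol n \<alpha>) (n + 1 - i) = (\<Sum>j\<le>n. if j = i then \<alpha> $ j else 0)"
    unfolding hankel_symbol_def coeff_sum
    using assms by (intro sum.cong) (auto simp: coeff_monom)
  with assms show ?thesis by simp
qed

lemma hankel_mat_carrier: "hankel_mat \<alpha> l m \<in> carrier_mat l m"
  by (simp add: hankel_mat_def)

lemma hankel_mult_vec_nth:
  assumes v: "v \<in> carrier_vec m" and lm: "l + m \<le> n + 2" and i: "i < l"
  shows "(hankel_mat \<alpha> l m *\<^sub>v v) $ i = coeff (poly_of_vec v * hankel_symbol n \<alpha>) (n + 1 - i)"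
proof -
  have "coeff (poly_of_vec v * hankel_symbol n \<alpha>) (n + 1 - i) =
      (\<Sum>k<m. v $ k * \<alpha> $ (i + k))"
    unfolding coeff_poly_of_vec_mult[OF v]
  proof (rule sum.cong)
    fix k assume "k \<in> {..<m}"
    with lm i have "k \<le> n + 1 - i" "i + k \<le> n" "n + 1 - i - k = n + 1 - (i + k)" by auto
    then show "(if k \<le> n + 1 - i then v $ k * coeff (hankel_symbol n \<alpha>) (n + 1 - i - k) else 0) =
        v $ k * \<alpha> $ (i + k)"
      by (simp only: coeff_hankel_symbol if_True)
  qed simp
  also have "\<dots> = (hankel_mat \<alpha> l m *\<^sub>v v) $ i"
    using v i by (auto simp: hankel_mat_def scalar_prod_def lessThan_atLeast0 mult.commute
        intro!: sum.cong)
  finally show ?thesis ..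
qed

text \<open>The rows of the matrix say that the coefficients of \<open>T ^ (n + 2 - l), \<dots>, T ^ (n + 1)\<close> in the
product with the symbol vanish, that is, that its residue modulo \<open>T ^ (n + 2)\<close> has degree at most
\<open>n + 1 - l\<close>. The bounds on \<open>l\<close> and \<open>m\<close> cover both the matrices with \<open>l + m = n + 2\<close> and the
square ones of the definition of \<open>\<rho>\<close>.\<close>

lemma hankel_kernel_iff:
  assumes v: "v \<in> carrier_vec m" and l: "0 < l" and m: "0 < m" and lm: "l + m \<le> n + 2"
  shows "v \<in> mat_kernel (hankel_mat \<alpha> l m) \<longleftrightarrow>
    (\<exists>u. (poly_of_vec v, u) \<in> congruence_lattice (hankel_symbol n \<alpha>) (n + 2) \<and> degree u \<le> n + 1 - l)"
    (is "?L \<longleftrightarrow> ?R")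
proof -
  define h where "h = poly_of_vec v * hankel_symbol n \<alpha>"
  have "?L \<longleftrightarrow> (\<forall>i<l. (hankel_mat \<alpha> l m *\<^sub>v v) $ i = 0)"
    using v hankel_mat_carrier[of \<alpha> l m]
    by (auto simp: mat_kernel[OF hankel_mat_carrier] vec_eq_iff simp del: index_mult_mat_vec)
  also have "\<dots> \<longleftrightarrow> (\<forall>i<l. coeff h (n + 1 - i) = 0)"
    using hankel_mult_vec_nth[OF v lm] by (simp add: h_def)
  also have "\<dots> \<longleftrightarrow> (\<forall>j. n + 1 - l < j \<and> j < n + 2 \<longrightarrow> coeff h j = 0)"
  proof (intro iffI allI impI)
    fix j assume H: "\<forall>i<l. coeff h (n + 1 - i) = 0" and j: "n + 1 - l < j \<and> j < n + 2"
    then have "n + 1 - j < l" "n + 1 - (n + 1 - j) = j" using lm l by auto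
    with H show "coeff h j = 0" by metis
  next
    fix i assume H: "\<forall>j. n + 1 - l < j \<and> j < n + 2 \<longrightarrow> coeff h j = 0" and i: "i < l"
    then have "n + 1 - l < n + 1 - i" using m lm by simp
    then show "coeff h (n + 1 - i) = 0" using H by simp
  qed
  also have "\<dots> \<longleftrightarrow> ?R"
  proof
    assume H: "\<forall>j. n + 1 - l < j \<and> j < n + 2 \<longrightarrow> coeff h j = 0"
    have "(poly_of_vec v, poly_cutoff (n + 2) h) \<in> congruence_lattice (hankel_symbol n \<alpha>) (n + 2)"
      by (simp add: congruence_lattice_def monom_1_dvd_iff' coeff_poly_cutoff h_def[symmetric])
    moreover have "degree (poly_cutoff (n + 2) h) \<le> n + 1 - l"
      using H by (intro degree_le) (auto simp: coeff_poly_cutoff)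
    ultimately show ?R by blast
  next
    assume ?R
    then obtain u where u: "\<forall>j<n + 2. coeff u j = coeff h j" "degree u \<le> n + 1 - l"
      by (auto simp: congruence_lattice_def monom_1_dvd_iff' h_def)
    then show "\<forall>j. n + 1 - l < j \<and> j < n + 2 \<longrightarrow> coeff h j = 0"
      by (metis coeff_eq_0 le_less_trans)
  qed
  finally show ?thesis .
qed

lemma hankel_ker_eq:
  assumes "m \<in> {1..n + 1}"
  shows "hankel_ker n \<alpha> m = {p. degree p \<le> m - 1 \<and>
    (\<exists>u. (p, u) \<in> congruence_lattice (hankel_symbol n \<alpha>) (n + 2) \<and> degree u \<le> m - 1)}"
    (is "_ = ?S")
proof -
  let ?H = "hankel_mat \<alpha> (n + 2 - m) m"
  have m: "0 < m" "0 < n + 2 - m" "n + 2 - m + m \<le> n + 2" "n + 1 - (n + 2 - m) = m - 1"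
    using assms by auto
  note iff = hankel_kernel_iff[OF _ m(2,1,3), unfolded m(4)]
  show ?thesis
  proof
    show "hankel_ker n \<alpha> m \<subseteq> ?S"
      unfolding hankel_ker_def
      using degree_poly_of_vec[OF _ m(1)] iff mat_kernelD(1)[OF hankel_mat_carrier] by blast
    show "?S \<subseteq> hankel_ker n \<alpha> m"
    proof
      fix p assume p: "p \<in> ?S"
      then have "poly_of_vec (vec m (coeff p)) = p" using m(1) by (intro poly_of_vec_coeff) auto
      moreover from this p have "vec m (coeff p) \<in> mat_kernel ?H"
        using iff[of "vec m (coeff p)" \<alpha>] by simp
      ultimately show "p \<in> hankel_ker n \<alpha> m"
        unfolding hankel_ker_def by (metis imageI)
    qed
  qed
qed

lemma poly_of_vec_in_hankel_ker_iff:
  assumes "v \<in> carrier_vec m"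
  shows "poly_of_vec v \<in> hankel_ker n \<alpha> m \<longleftrightarrow> v \<in> mat_kernel (hankel_mat \<alpha> (n + 2 - m) m)"
proof
  assume "poly_of_vec v \<in> hankel_ker n \<alpha> m"
  then obtain w where w: "w \<in> mat_kernel (hankel_mat \<alpha> (n + 2 - m) m)"
    and eq: "poly_of_vec v = poly_of_vec w"
    unfolding hankel_ker_def by auto
  have "v = w"
    using poly_of_vec_inj[OF assms mat_kernelD(1)[OF hankel_mat_carrier w] eq] .
  with w show "v \<in> mat_kernel (hankel_mat \<alpha> (n + 2 - m) m)" by simp
qed (simp add: hankel_ker_def)

lemma det_hankel_eq_0_iff:
  assumes "1 \<le> l" "l \<le> hankel_n1 n"
  shows "det (hankel_mat \<alpha> l l) = 0 \<longleftrightarrow>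
    (\<exists>p u. p \<noteq> 0 \<and> (p, u) \<in> congruence_lattice (hankel_symbol n \<alpha>) (n + 2) \<and>
      degree p < l \<and> degree u \<le> n + 1 - l)"
    (is "_ \<longleftrightarrow> ?R")
proof -
  have ll: "0 < l" "l + l \<le> n + 2" using assms by (auto simp: hankel_n1_def)
  note iff = hankel_kernel_iff[OF _ ll(1,1,2)]
  have "det (hankel_mat \<alpha> l l) = 0 \<longleftrightarrow>
      (\<exists>v. v \<in> carrier_vec l \<and> v \<noteq> 0\<^sub>v l \<and> v \<in> mat_kernel (hankel_mat \<alpha> l l))"
    unfolding det_0_iff_vec_prod_zero_field[OF hankel_mat_carrier] mat_kernel[OF hankel_mat_carrier]
    by auto
  also have "\<dots> \<longleftrightarrow> ?R"
  proof
    assume "\<exists>v. v \<in> carrier_vec l \<and> v \<noteq> 0\<^sub>v l \<and> v \<in> mat_kernel (hankel_mat \<alpha> l l)"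
    then obtain v where v: "v \<in> carrier_vec l" "v \<noteq> 0\<^sub>v l" "v \<in> mat_kernel (hankel_mat \<alpha> l l)"
      by blast
    then have "poly_of_vec v \<noteq> 0" "degree (poly_of_vec v) < l"
      using poly_of_vec_eq_0_iff degree_poly_of_vec[OF _ ll(1)] ll(1) by force+
    with v iff show ?R by blast
  next
    assume ?R
    then obtain p u where p: "p \<noteq> 0" "(p, u) \<in> congruence_lattice (hankel_symbol n \<alpha>) (n + 2)"
      "degree p < l" "degree u \<le> n + 1 - l" by blast
    have eq: "poly_of_vec (vec l (coeff p)) = p" using p(3) by (rule poly_of_vec_coeff)
    have "vec l (coeff p) \<in> mat_kernel (hankel_mat \<alpha> l l)"
      using p iff[of "vec l (coeff p)" \<alpha>] eq by auto
    moreover have "vec l (coeff p) \<noteq> 0\<^sub>v l"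
      using eq p(1) poly_of_vec_eq_0_iff[of "vec l (coeff p)" l] by auto
    ultimately show "\<exists>v. v \<in> carrier_vec l \<and> v \<noteq> 0\<^sub>v l \<and> v \<in> mat_kernel (hankel_mat \<alpha> l l)"
      by (intro exI[of _ "vec l (coeff p)"]) auto
  qed
  finally show ?thesis .
qed

section \<open>Kernels, rank and minors from a reduced basis\<close>

lemma degree_bound_iff:
  fixes B :: "'a::zero poly"
  assumes "d + 1 \<le> m"
  shows "(B = 0 \<or> degree B + d \<le> m - 1) \<longleftrightarrow> degree B \<le> m - d - 1"
  using assms by auto

locale hankel_basis = reduced_basis "hankel_symbol n \<alpha>" "n + 2" d1 d2 p1 u1 p2 u2
  for n :: nat and \<alpha> :: "'a::field vec" and d1 d2 :: nat and p1 u1 p2 u2 :: "'a poly"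
begin

lemma p1_nz: "p1 \<noteq> 0"
  by (rule p1_nonzero) simp

lemma hankel_ker_eq_combinations:
  assumes "m \<in> {1..n + 1}"
  shows "hankel_ker n \<alpha> m = {B1 * p1 + B2 * p2 | B1 B2.
    (B1 = 0 \<or> degree B1 + d1 \<le> m - 1) \<and> (B2 = 0 \<or> degree B2 + d2 \<le> m - 1)}"
  unfolding hankel_ker_eq[OF assms] using assms by (intro bounded_elements_eq) auto

lemma hankel_ker_trivial:
  assumes "m \<in> {1..n + 1}" "m \<le> d1"
  shows "hankel_ker n \<alpha> m = {0}"
proof -
  have "\<not> k + d1 \<le> m - 1" "\<not> k + d2 \<le> m - 1" for k using assms degree_le by auto
  then show ?thesis unfolding hankel_ker_eq_combinations[OF assms(1)] by auto
qed

lemma hankel_ker_principal: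
  assumes "m \<in> {1..n + 1}" "d1 + 1 \<le> m" "m \<le> d2"
  shows "hankel_ker n \<alpha> m = {B1 * p1 | B1. degree B1 \<le> m - d1 - 1}"
proof -
  have "\<not> k + d2 \<le> m - 1" for k using assms by auto
  then show ?thesis
    unfolding hankel_ker_eq_combinations[OF assms(1)] degree_bound_iff[OF assms(2)] by auto
qed

lemma hankel_ker_two_generators:
  assumes "m \<in> {1..n + 1}" "d2 + 1 \<le> m"
  shows "hankel_ker n \<alpha> m = {B1 * p1 + B2 * p2 | B1 B2.
    degree B1 \<le> m - d1 - 1 \<and> degree B2 \<le> m - d2 - 1}"
proof -
  have "d1 + 1 \<le> m" using assms degree_le by simp
  then show ?thesis
    unfolding hankel_ker_eq_combinations[OF assms(1)] degree_bound_iff[OF assms(2)]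
    by (simp only: degree_bound_iff)
qed

lemma hankel_sizes:
  "d1 \<le> hankel_n1 n" "hankel_n2 n \<le> d2" "hankel_n2 n \<in> {1..n + 1}"
  "n + 2 - hankel_n2 n = hankel_n1 n" "d1 \<le> hankel_n2 n"
  using degree_sum degree_le unfolding hankel_n1_def hankel_n2_def atLeastAtMost_iff by linarith+

text \<open>For \<open>m = n2\<close> the kernel consists of the multiples of \<open>p1\<close> by polynomials of degree below
\<open>m - d1\<close>, so it has dimension \<open>m - d1\<close>, and rank-nullity gives the rank \<open>d1\<close>.\<close>

lemma hankel_rank_eq: "hankel_rank n \<alpha> = d1"
proof -
  define m where "m = hankel_n2 n"
  define k where "k = m - d1"
  let ?A = "hankel_mat \<alpha> (hankel_n1 n) m" and ?C = "convolution_mat p1 m k"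
  have m: "m \<in> {1..n + 1}" "m \<le> d2" "n + 2 - m = hankel_n1 n" "d1 + k = m"
    using hankel_sizes by (auto simp: m_def k_def)
  have ker: "hankel_ker n \<alpha> m = {B * p1 | B. B = 0 \<or> degree B < k}"
  proof (cases "k = 0")
    case True
    then show ?thesis using hankel_ker_trivial[OF m(1)] m(4) by auto
  next
    case False
    then have "degree B \<le> m - d1 - 1 \<longleftrightarrow> B = 0 \<or> degree B < k" for B :: "'a poly"
      using m(4) by auto
    then show ?thesis using hankel_ker_principal[OF m(1) _ m(2)] m(4) False by simp
  qed
  \<comment> \<open>For \<open>k = 0\<close> the degree bound is false and only the zero polynomial remains.\<close>
  have small: "poly_of_vec x = 0 \<or> degree (poly_of_vec x) < k"
    if "x \<in> carrier_vec k" for x :: "'a vec"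
    using degree_poly_of_vec[OF that] poly_of_vec_eq_0_iff[OF that] that by (cases "k = 0") auto
  have conv: "poly_of_vec (?C *\<^sub>v x) = poly_of_vec x * p1" if x: "x \<in> carrier_vec k" for x
  proof (rule poly_of_convolution_mat_mult[OF x])
    show "degree (poly_of_vec x * p1) < m"
      using small[OF x] degree_mult_le[of "poly_of_vec x" p1] deg1(1) m(1,4) by fastforce
  qed
  have C_vec: "?C *\<^sub>v x \<in> carrier_vec m" if "x \<in> carrier_vec k" for x
    using mult_mat_vec_carrier[OF convolution_mat_carrier that] .
  have inj: "mat_kernel ?C = {0\<^sub>v k}"
  proof
    show "mat_kernel ?C \<subseteq> {0\<^sub>v k}"
    proof
      fix x assume "x \<in> mat_kernel ?C"
      then have x: "x \<in> carrier_vec k" "?C *\<^sub>v x = 0\<^sub>v m"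
        using mat_kernelD[OF convolution_mat_carrier] by blast+
      then have "poly_of_vec x * p1 = 0"
        using conv[OF x(1), unfolded x(2)] poly_of_vec_eq_0_iff[of "0\<^sub>v m" m]
        by (metis zero_carrier_vec)
      with p1_nz x(1) show "x \<in> {0\<^sub>v k}" by (simp add: poly_of_vec_eq_0_iff)
    qed
    show "{0\<^sub>v k} \<subseteq> mat_kernel ?C"
    proof -
      have "?C *\<^sub>v 0\<^sub>v k = 0\<^sub>v m"
        by (intro eq_vecI) (auto simp: convolution_mat_def scalar_prod_def)
      then show ?thesis by (simp add: mat_kernel[OF convolution_mat_carrier])
    qed
  qed
  have exact: "mat_kernel ?A = (*\<^sub>v) ?C ` carrier_vec k"
  proof
    show "mat_kernel ?A \<subseteq> (*\<^sub>v) ?C ` carrier_vec k"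
    proof
      fix v assume v: "v \<in> mat_kernel ?A"
      then have vc: "v \<in> carrier_vec m" by (rule mat_kernelD(1)[OF hankel_mat_carrier])
      with v m(3) have "poly_of_vec v \<in> hankel_ker n \<alpha> m"
        by (simp add: poly_of_vec_in_hankel_ker_iff)
      then obtain B where B: "poly_of_vec v = B * p1" "B = 0 \<or> degree B < k"
        unfolding ker by blast
      have "poly_of_vec (vec k (coeff B)) = B"
        using B(2) by (auto intro!: poly_eqI simp: coeff_poly_of_vec coeff_eq_0)
      then have "poly_of_vec (?C *\<^sub>v vec k (coeff B)) = poly_of_vec v"
        using conv[of "vec k (coeff B)"] B(1) by simp
      then have "?C *\<^sub>v vec k (coeff B) = v"
        using poly_of_vec_inj[OF C_vec vc] by simp
      then show "v \<in> (*\<^sub>v) ?C ` carrier_vec k" by (metis imageI vec_carrier)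
    qed
    show "(*\<^sub>v) ?C ` carrier_vec k \<subseteq> mat_kernel ?A"
    proof clarify
      fix x :: "'a vec" assume x: "x \<in> carrier_vec k"
      have "poly_of_vec (?C *\<^sub>v x) \<in> hankel_ker n \<alpha> m"
        unfolding ker conv[OF x] using small[OF x] by blast
      then show "?C *\<^sub>v x \<in> mat_kernel ?A"
        using poly_of_vec_in_hankel_ker_iff[OF C_vec[OF x]] m(3) by simp
    qed
  qed
  have "hankel_rank n \<alpha> + k = m"
    unfolding hankel_rank_def m_def[symmetric]
    by (rule rank_of_exact_sequence[OF hankel_mat_carrier convolution_mat_carrier inj exact])
  with m(4) show ?thesis by simp
qed

text \<open>The element \<open>(p1, u1)\<close> itself is a kernel vector: its second component is small enough as soon as
\<open>d1 + l \<le> n + 1\<close>. This fails only when \<open>d1 = l = n1\<close> and \<open>n\<close> is even, in which case \<open>d1 = d2\<close>,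
and the rule for ties makes \<open>degree p1 < l\<close> impossible.\<close>

lemma det_hankel_eq_0_above:
  assumes "degree p1 < l" "l \<le> hankel_n1 n"
  shows "det (hankel_mat \<alpha> l l) = 0"
proof -
  have "d1 \<le> n + 1 - l"
  proof (cases "d1 = d2")
    case True
    with degree_tie degree_sum assms show ?thesis by (auto simp: hankel_n1_def)
  next
    case False
    with degree_le degree_sum assms show ?thesis by (auto simp: hankel_n1_def)
  qed
  with deg1(2) have "degree u1 \<le> n + 1 - l" by simp
  with assms p1_nz mem1 show ?thesis by (subst det_hankel_eq_0_iff[of l n]) auto
qed

text \<open>A kernel vector gives a lattice element \<open>(p, u)\<close> for which \<open>p1 * u - u1 * p\<close> has degree below
\<open>n + 2\<close>. By Cramer's rule its second coordinate is zero, so \<open>p\<close> is a nonzero multiple of \<open>p1\<close> of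
smaller degree.\<close>

lemma det_hankel_at_degree:
  assumes "0 < degree p1"
  shows "det (hankel_mat \<alpha> (degree p1) (degree p1)) \<noteq> 0"
proof
  assume "det (hankel_mat \<alpha> (degree p1) (degree p1)) = 0"
  moreover have "1 \<le> degree p1" "degree p1 \<le> hankel_n1 n"
    using assms deg1(1) hankel_sizes(1) by auto
  ultimately obtain p u where p: "p \<noteq> 0"
    "(p, u) \<in> congruence_lattice (hankel_symbol n \<alpha>) (n + 2)"
    "degree p < degree p1" "degree u \<le> n + 1 - degree p1"
    using det_hankel_eq_0_iff[of "degree p1" n] by blast
  obtain B1 B2 where B: "p = B1 * p1 + B2 * p2" "monom 1 (n + 2) * B2 = p1 * u - u1 * p"
    by (rule cramer[OF p(2)])
  have "degree (p1 * u) \<le> n + 1"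
    using degree_mult_le[of p1 u] p(4) deg1(1) degree_sum degree_le by linarith
  moreover have "degree (u1 * p) \<le> n + 1"
    using degree_mult_le[of u1 p] p(3) deg1 degree_sum degree_le by linarith
  ultimately have "degree (monom 1 (n + 2) * B2) \<le> n + 1"
    unfolding B(2) by (rule degree_diff_le)
  then have "B2 = 0" using degree_monom_mult_bound by force
  with B(1) have "p = B1 * p1" by simp
  with p(1) have "degree p = degree B1 + degree p1"
    using degree_mult_eq[of B1 p1] p1_nz by auto
  with p(3) show False by simp
qed

lemma hankel_rho_eq: "hankel_rho n \<alpha> = degree p1"
proof -
  let ?S = "{l \<in> {1..hankel_n1 n}. det (hankel_mat \<alpha> l l) \<noteq> 0}"
  have bound: "l \<le> degree p1" if "l \<in> ?S" for l
    using that det_hankel_eq_0_above[of l] by force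
  show ?thesis
  proof (cases "degree p1 = 0")
    case True
    with bound have "?S = {}" by force
    with True show ?thesis by (auto simp: hankel_rho_def)
  next
    case False
    then have mem: "degree p1 \<in> ?S"
      using det_hankel_at_degree deg1(1) hankel_sizes(1) by auto
    have "Max ?S = degree p1" by (rule Max_eqI) (use bound mem in auto)
    with mem show ?thesis by (auto simp: hankel_rho_def)
  qed
qed

text \<open>For \<open>d1 = 0\<close> the lattice contains a pair of constants with nonzero first entry, so the symbol is
constant modulo \<open>T ^ (n + 2)\<close>. Conversely, if the symbol is zero then \<open>(1, 0)\<close> is a lattice
element of size 0.\<close>

lemma d1_eq_0_iff:
  assumes "\<alpha> \<in> carrier_vec (n + 1)"
  shows "d1 = 0 \<longleftrightarrow> \<alpha> = 0\<^sub>v (n + 1)"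
proof
  assume "d1 = 0"
  with deg1 have "degree p1 = 0" and u1: "degree u1 = 0" by auto
  then obtain c where p1: "p1 = [:c:]" by (metis degree_eq_zeroE)
  with p1_nz have "c \<noteq> 0" by simp
  have coeffs: "coeff u1 j = c * coeff (hankel_symbol n \<alpha>) j" if "j < n + 2" for j
    using mem1 that by (auto simp: congruence_lattice_def monom_1_dvd_iff' p1)
  have "\<alpha> $ i = 0" if "i \<le> n" for i
    using coeffs[of "n + 1 - i"] coeff_hankel_symbol[OF that, of \<alpha>] u1 that \<open>c \<noteq> 0\<close>
    by (simp add: coeff_eq_0)
  with assms show "\<alpha> = 0\<^sub>v (n + 1)" by auto
next
  assume "\<alpha> = 0\<^sub>v (n + 1)"
  then have "hankel_symbol n \<alpha> = 0" by (simp add: hankel_symbol_def)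
  then have "(1, 0) \<in> congruence_lattice (hankel_symbol n \<alpha>) (n + 2)"
    by (simp add: congruence_lattice_def)
  then obtain B1 B2 where B: "1 = B1 * p1 + B2 * p2"
    "B1 = 0 \<or> degree B1 + d1 \<le> 0" "B2 = 0 \<or> degree B2 + d2 \<le> 0"
    by (rule expansion[where k = 0]) simp_all
  have "B1 \<noteq> 0 \<or> B2 \<noteq> 0" using B(1) by auto
  with B(2,3) degree_le show "d1 = 0" by auto
qed

end

lemma ex_hankel_basis: "\<exists>d1 d2 p1 u1 p2 u2. hankel_basis n \<alpha> d1 d2 p1 u1 p2 u2"
  unfolding hankel_basis_def by (rule ex_reduced_basis)

section \<open>The structure theorem\<close>

text \<open>In rank at most 1 the conventional second generator is coprime to the first one for trivial
reasons: either \<open>A1\<close> is a nonzero constant, or the convention prescribes 1.\<close>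

lemma hankel_A2_convention_exists:
  fixes \<alpha> :: "'a::field vec"
  assumes "A1 \<noteq> 0" and r: "hankel_rank n \<alpha> \<le> 1" and "degree A1 = hankel_rho n \<alpha>"
    and le: "hankel_rho n \<alpha> \<le> hankel_rank n \<alpha>"
  shows "\<exists>A2. coprime A1 A2 \<and> degree A2 \<le> n + 1 \<and> hankel_A2_convention n \<alpha> A2"
proof (cases "hankel_rho n \<alpha> = 0")
  case True
  with assms have "is_unit A1" by (simp add: is_unit_iff_degree)
  then have cop: "coprime A1 A2" for A2 by (rule is_unit_left_imp_coprime)
  let ?A2 = "if hankel_rank n \<alpha> = 0 then 0 else monom 1 (n + 1)"
  have "hankel_A2_convention n \<alpha> ?A2"
    using True by (auto simp: hankel_A2_convention_def hankel_L_def)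
  moreover have "degree ?A2 \<le> n + 1" by (auto simp: degree_monom_le)
  ultimately show ?thesis using cop by blast
next
  case False
  with r le have "hankel_A2_convention n \<alpha> 1"
    by (auto simp: hankel_A2_convention_def hankel_L_def)
  then show ?thesis by (intro exI[of _ 1]) auto
qed

theorem theorem2p4p4:
  fixes \<alpha> :: "'a::{field,finite} vec"
    and n r \<rho>\<^sub>1 \<pi>\<^sub>1 c\<^sub>1 c\<^sub>2 :: nat
  assumes "n > 0"
    and "\<alpha> \<in> hankel_L n r \<rho>\<^sub>1 \<pi>\<^sub>1"
    and "c\<^sub>1 = r"
    and "c\<^sub>2 = n - r + 2"
  shows "(\<exists>A\<^sub>1 A\<^sub>2. hankel_poly_pair n \<alpha> \<rho>\<^sub>1 c\<^sub>1 c\<^sub>2 A\<^sub>1 A\<^sub>2 \<and> hankel_A2_convention n \<alpha> A\<^sub>2) \<and>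
    (\<forall>A\<^sub>1 A\<^sub>2. hankel_poly_pair n \<alpha> \<rho>\<^sub>1 c\<^sub>1 c\<^sub>2 A\<^sub>1 A\<^sub>2 \<and> hankel_A2_convention n \<alpha> A\<^sub>2 \<longrightarrow>
       (\<rho>\<^sub>1 \<noteq> r \<longrightarrow> degree A\<^sub>2 = c\<^sub>2) \<and>
       (r \<in> {0, 1} \<longrightarrow>
          (\<forall>m\<in>{1..n + 1}.
             (m \<le> c\<^sub>1 \<longrightarrow> hankel_ker n \<alpha> m = {0}) \<and>
             (c\<^sub>1 + 1 \<le> m \<longrightarrow>
                hankel_ker n \<alpha> m = {B\<^sub>1 * A\<^sub>1 | B\<^sub>1. degree B\<^sub>1 \<le> m - c\<^sub>1 - 1})))) \<and>
    (r \<in> {0, 1} \<longrightarrow> \<alpha> \<in> hankel_L n 0 0 0 \<union> hankel_L n 1 1 0 \<union> hankel_L n 1 0 1) \<and>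
    (\<alpha> \<in> hankel_L n 0 0 0 \<longleftrightarrow> \<alpha> = 0\<^sub>v (n + 1))"
proof -
  obtain d1 d2 p1 u1 p2 u2 where "hankel_basis n \<alpha> d1 d2 p1 u1 p2 u2"
    using ex_hankel_basis by blast
  then interpret hankel_basis n \<alpha> d1 d2 p1 u1 p2 u2 .
  have carrier: "\<alpha> \<in> carrier_vec (n + 1)" and r: "r = d1" and \<rho>: "\<rho>\<^sub>1 = degree p1"
    using assms(2) hankel_rank_eq hankel_rho_eq by (auto simp: hankel_L_def hankel_pi_def)
  have L_iff: "\<alpha> \<in> hankel_L n s \<sigma> \<tau> \<longleftrightarrow> s = r \<and> \<sigma> = \<rho>\<^sub>1 \<and> \<tau> = r - \<rho>\<^sub>1" for s \<sigma> \<tau>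
    using carrier r \<rho> hankel_rank_eq hankel_rho_eq by (auto simp: hankel_L_def hankel_pi_def)
  have \<rho>_le: "\<rho>\<^sub>1 \<le> r" using deg1(1) r \<rho> by simp
  have "r \<le> n" using hankel_sizes(1) r assms(1) by (simp add: hankel_n1_def)
  then have c: "c\<^sub>1 = d1" "c\<^sub>2 = d2" using assms(3,4) r degree_sum by auto

  have ex: "\<exists>A\<^sub>1 A\<^sub>2. hankel_poly_pair n \<alpha> \<rho>\<^sub>1 c\<^sub>1 c\<^sub>2 A\<^sub>1 A\<^sub>2 \<and> hankel_A2_convention n \<alpha> A\<^sub>2"
  proof (cases "r \<le> 1")
    case True
    then obtain A2 where A2: "coprime p1 A2" "degree A2 \<le> n + 1" "hankel_A2_convention n \<alpha> A2"
      using hankel_A2_convention_exists[OF p1_nz, of n \<alpha>] hankel_rank_eq hankel_rho_eq r deg1(1)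
      by auto
    \<comment> \<open>No column number \<open>m \<le> n + 1\<close> exceeds \<open>d2\<close>, so the kernels put no condition on \<open>A2\<close>.\<close>
    have "n + 1 \<le> d2" using True r degree_sum by simp
    with A2 have "hankel_poly_pair n \<alpha> \<rho>\<^sub>1 c\<^sub>1 c\<^sub>2 p1 A2"
      unfolding hankel_poly_pair_def c \<rho>
      using p1_nz hankel_ker_trivial hankel_ker_principal by auto
    with A2(3) show ?thesis by blast
  next
    case False
    then have "hankel_A2_convention n \<alpha> p2"
      by (simp add: hankel_A2_convention_def L_iff)
    moreover have "hankel_poly_pair n \<alpha> \<rho>\<^sub>1 c\<^sub>1 c\<^sub>2 p1 p2"
      unfolding hankel_poly_pair_def c \<rho>
      using coprime_generators p1_nz deg2(1) hankel_ker_trivial hankel_ker_principal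
        hankel_ker_two_generators by blast
    ultimately show ?thesis by blast
  qed

  have deg_A2: "degree A\<^sub>2 = c\<^sub>2"
    if pair: "hankel_poly_pair n \<alpha> \<rho>\<^sub>1 c\<^sub>1 c\<^sub>2 A\<^sub>1 A\<^sub>2" and conv: "hankel_A2_convention n \<alpha> A\<^sub>2"
      and ne: "\<rho>\<^sub>1 \<noteq> r" for A\<^sub>1 A\<^sub>2
  proof (cases "r \<le> 1")
    case True
    with ne \<rho>_le have "r = 1" "\<rho>\<^sub>1 = 0" by auto
    with conv have "A\<^sub>2 = monom 1 (n + 1)" by (simp add: hankel_A2_convention_def L_iff)
    then show ?thesis using assms(4) \<open>r = 1\<close> \<open>r \<le> n\<close> by (simp add: degree_monom_eq)
  next
    case False
    \<comment> \<open>\<open>p2\<close> lies in the kernel with \<open>d2 + 1\<close> columns and has degree \<open>d2\<close>. In that kernel the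
      multiples of \<open>A1\<close> stay below degree \<open>d2\<close> when \<open>\<rho> < r\<close>, so \<open>A2\<close> must reach it.\<close>
    then have m: "d2 + 1 \<in> {1..n + 1}" using degree_sum r by simp
    have "p2 \<in> hankel_ker n \<alpha> (d2 + 1)"
      unfolding hankel_ker_eq_combinations[OF m] by (intro CollectI exI[of _ 0] exI[of _ 1]) auto
    moreover have "hankel_ker n \<alpha> (d2 + 1) = {B\<^sub>1 * A\<^sub>1 + B\<^sub>2 * A\<^sub>2 | B\<^sub>1 B\<^sub>2.
        degree B\<^sub>1 \<le> d2 + 1 - d1 - 1 \<and> degree B\<^sub>2 \<le> d2 + 1 - d2 - 1}"
      using pair m unfolding hankel_poly_pair_def c by blast
    ultimately obtain B\<^sub>1 B\<^sub>2 where B: "p2 = B\<^sub>1 * A\<^sub>1 + B\<^sub>2 * A\<^sub>2"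
      "degree B\<^sub>1 \<le> d2 - d1" "degree B\<^sub>2 = 0" by auto
    have "degree A\<^sub>1 = \<rho>\<^sub>1" "degree A\<^sub>2 \<le> d2"
      using pair unfolding hankel_poly_pair_def c by auto
    moreover have "\<rho>\<^sub>1 < d1" using ne \<rho>_le r by simp
    ultimately have lt: "degree (B\<^sub>1 * A\<^sub>1) < d2"
      using degree_mult_le[of B\<^sub>1 A\<^sub>1] B(2) degree_le by linarith
    have "degree p2 = d2" using degree_p2 ne r \<rho> by simp
    then have "\<not> degree (B\<^sub>2 * A\<^sub>2) < d2"
      using B(1) lt degree_add_less[of "B\<^sub>1 * A\<^sub>1" d2 "B\<^sub>2 * A\<^sub>2"] by auto
    then have "d2 \<le> degree A\<^sub>2"
      using degree_mult_le[of B\<^sub>2 A\<^sub>2] B(3) by simp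
    with \<open>degree A\<^sub>2 \<le> d2\<close> show ?thesis using c by simp
  qed

  have small: "(m \<le> c\<^sub>1 \<longrightarrow> hankel_ker n \<alpha> m = {0}) \<and>
      (c\<^sub>1 + 1 \<le> m \<longrightarrow> hankel_ker n \<alpha> m = {B\<^sub>1 * A\<^sub>1 | B\<^sub>1. degree B\<^sub>1 \<le> m - c\<^sub>1 - 1})"
    if "hankel_poly_pair n \<alpha> \<rho>\<^sub>1 c\<^sub>1 c\<^sub>2 A\<^sub>1 A\<^sub>2" "r \<in> {0, 1}" "m \<in> {1..n + 1}" for A\<^sub>1 A\<^sub>2 m
  proof -
    have "m \<le> c\<^sub>2" using that(2,3) assms(4) by auto
    with that(1,3) show ?thesis unfolding hankel_poly_pair_def by blast
  qed

  have "r \<in> {0, 1} \<longrightarrow> \<alpha> \<in> hankel_L n 0 0 0 \<union> hankel_L n 1 1 0 \<union> hankel_L n 1 0 1"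
    using \<rho>_le by (auto simp: L_iff)
  moreover have "\<alpha> \<in> hankel_L n 0 0 0 \<longleftrightarrow> \<alpha> = 0\<^sub>v (n + 1)"
    using d1_eq_0_iff[OF carrier] \<rho>_le r by (auto simp: L_iff)
  ultimately show ?thesis using ex deg_A2 small by blast
qed

end
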